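(* If $(G,\tau)$ is a Hausdorff Abelian first-countable paratopological group, then $G$ is submetrizable.
   Context: A paratopological group is a group $G$ with a topology such that the product map $G\times G\to G$ is jointly continuous. A space $X$ is submetrizable if it can be mapped onto a metric space by a continuous one-to-one map. *)

theory Defs
  imports "HOL-Analysis.Analysis" "HOL-Algebra.Group"
begin

locale paratopological_group = group G for G :: "('a, 'b) monoid_scheme" (structure) +
  fixes \<tau> :: "'a topology"
  assumes topspace_eq_carrier: "topspace \<tau> = carrier G"
    and continuous_mult: "continuous_map (prod_topology \<tau> \<tau>) \<tau> (\<lambda>(x, y). x \<otimes> y)"

text \<open>The metric space is sought on subsets of the type of points of \<open>X\<close>, since the right-hand side
  of a definition cannot quantify over types. Nothing is lost: the map is a bijection,
  so a metric on another type can be transported back, see \<open>submetrizableI\<close>.\<close>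

definition submetrizable :: "'a topology \<Rightarrow> bool" where
  "submetrizable X \<longleftrightarrow>
    (\<exists>(M :: 'a set) d f. Metric_space M d \<and>
       continuous_map X (Metric_space.mtopology M d) f \<and>
       f ` topspace X = M \<and> inj_on f (topspace X))"

lemma submetrizableI:
  fixes X :: "'a topology" and M :: "'b set"
  assumes M: "Metric_space M d"
    and f: "continuous_map X (Metric_space.mtopology M d) f"
    and onto: "f ` topspace X = M" and inj: "inj_on f (topspace X)"
  shows "submetrizable X"
proof -
  interpret M: Metric_space M d by (rule M)
  define e where "e = (\<lambda>x y. d (f x) (f y))"
  have e_nonneg: "0 \<le> e x y" and e_commute: "e x y = e y x" for x y
    by (auto simp: e_def M.commute)
  interpret E: Metric_space "topspace X" e
  proof
    fix x y assume "x \<in> topspace X" "y \<in> topspace X"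
    then show "e x y = 0 \<longleftrightarrow> x = y"
      using inj onto by (auto simp: e_def inj_on_def)
  next
    fix x y z assume "x \<in> topspace X" "y \<in> topspace X" "z \<in> topspace X"
    then show "e x z \<le> e x y + e y z"
      using onto M.triangle by (auto simp: e_def)
  qed (use e_nonneg e_commute in auto)
  have "continuous_map X E.mtopology (\<lambda>x. x)"
    unfolding E.continuous_map_to_metric
  proof (intro ballI allI impI)
    fix x and \<epsilon> :: real assume x: "x \<in> topspace X" and "\<epsilon> > 0"
    then obtain U where "openin X U" "x \<in> U" "\<forall>y\<in>U. f y \<in> M.mball (f x) \<epsilon>"
      using f unfolding M.continuous_map_to_metric by meson
    moreover from this have "U \<subseteq> topspace X" by (simp add: openin_subset)
    ultimately have "\<forall>y\<in>U. y \<in> E.mball x \<epsilon>"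
      using x by (auto simp: E.in_mball M.in_mball) (auto simp: e_def)
    then show "\<exists>U. openin X U \<and> x \<in> U \<and> (\<forall>y\<in>U. y \<in> E.mball x \<epsilon>)"
      using \<open>openin X U\<close> \<open>x \<in> U\<close> by blast
  qed
  then show ?thesis
    unfolding submetrizable_def using E.Metric_space_axioms
    by (intro exI[of _ "topspace X"] exI[of _ e] exI[of _ "\<lambda>x. x"]) auto
qed

end

theory Submission
  imports Defs
begin

text \<open>The sets \<open>U n\<close> of a suitable neighbourhood base at \<open>\<one>\<close> satisfy \<open>U (n + 1)\<^sup>3 \<subseteq> U n\<close>. As \<open>G\<close> is
  Abelian, the relations \<open>x \<cdot> U n \<inter> y \<cdot> U n \<noteq> {}\<close> then form a sequence of symmetric entourages, the
  composition of three copies of one being contained in the preceding one, and their intersection is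
  the diagonal because \<open>\<tau>\<close> is Hausdorff. Frink's chain construction turns them into a metric,
  whose topology is coarser than \<open>\<tau>\<close> because \<open>x \<cdot> U n\<close> is a \<open>\<tau>\<close>-neighbourhood of \<open>x\<close>.\<close>

section \<open>Chains of entourages and Frink's metrization\<close>

inductive weighted_chain :: "(nat \<Rightarrow> 'a rel) \<Rightarrow> nat \<Rightarrow> 'a \<Rightarrow> 'a \<Rightarrow> real \<Rightarrow> bool"
  for E :: "nat \<Rightarrow> 'a rel" where
  refl: "weighted_chain E 0 x x 0"
| step: "(x, y) \<in> E n \<Longrightarrow> weighted_chain E k y z s \<Longrightarrow> weighted_chain E (Suc k) x z ((1/2)^n + s)"

lemma weighted_chain_nonneg: "weighted_chain E k x y s \<Longrightarrow> 0 \<le> s"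
  by (induction rule: weighted_chain.induct) auto

lemma weighted_chain_single: "(x, y) \<in> E n \<Longrightarrow> weighted_chain E 1 x y ((1/2)^n)"
  using weighted_chain.step[OF _ weighted_chain.refl, of x y E n] by simp

lemma weighted_chain_append:
  "weighted_chain E k x y s \<Longrightarrow> weighted_chain E l y z t \<Longrightarrow> weighted_chain E (k + l) x z (s + t)"
  by (induction rule: weighted_chain.induct) (auto simp: add.assoc intro: weighted_chain.step)

lemma weighted_chain_sym:
  assumes "\<And>n. sym (E n)" and "weighted_chain E k x y s"
  shows "weighted_chain E k y x s"
  using assms(2)
proof (induction rule: weighted_chain.induct)
  case (step x y n k z s)
  then have "(y, x) \<in> E n" using assms(1) by (meson symD)
  from weighted_chain_append[OF step.IH weighted_chain_single[of y x E, OF this]]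
  show ?case by (simp add: add.commute)
qed (rule weighted_chain.refl)

text \<open>The middle link is the first one at which the accumulated weight reaches
  \<open>h\<close>, or the last one if the weight never does. In the latter case nothing follows it,
  which is why the bound on \<open>s2\<close> needs \<open>max 0\<close>.\<close>

lemma weighted_chain_split:
  assumes "weighted_chain E k x y s" and "k > 0" and "0 \<le> h"
  shows "\<exists>i a s1 n b j s2. weighted_chain E i x a s1 \<and> (a, b) \<in> E n \<and> weighted_chain E j b y s2 \<and>
           i < k \<and> j < k \<and> s1 + (1/2)^n + s2 = s \<and> s1 \<le> h \<and> s2 \<le> max 0 (s - h)"
  using assms
proof (induction arbitrary: h rule: weighted_chain.induct)
  case (step x y n k z s)
  show ?case
  proof (cases "k = 0 \<or> h \<le> (1/2)^n")
    case True
    then have "s \<le> max 0 ((1/2)^n + s - h)"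
      using step.hyps(2) by (auto elim: weighted_chain.cases)
    then show ?thesis
      using step.hyps step.prems weighted_chain.refl[of E x]
      by (intro exI[of _ 0] exI[of _ x] exI[of _ "0::real"] exI[of _ n] exI[of _ y] exI[of _ k]
          exI[of _ s]) auto
  next
    case False
    then obtain i a s1 m b j s2 where
      *: "weighted_chain E i y a s1" "(a, b) \<in> E m" "weighted_chain E j b z s2" "i < k" "j < k"
        "s1 + (1/2)^m + s2 = s" "s1 \<le> h - (1/2)^n" "s2 \<le> max 0 (s - (h - (1/2)^n))"
      using step.IH[of "h - (1/2)^n"] by auto
    show ?thesis
      using * weighted_chain.step[OF step.hyps(1) *(1)]
      by (intro exI[of _ "Suc i"] exI[of _ a] exI[of _ "(1/2)^n + s1"] exI[of _ m] exI[of _ b]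
          exI[of _ j] exI[of _ s2]) (auto simp: algebra_simps)
  qed
qed simp

text \<open>Strong induction on the number \<open>k\<close> of links, which is recorded in
  \<open>weighted_chain\<close> for this purpose. Cutting at half the weight leaves two shorter
  chains of weight below \<open>(1/2)^Suc m\<close>, and the link between them has cost at most
  \<open>s < (1/2)^m\<close>, hence index at least \<open>Suc m\<close>. The three resulting pairs
  in \<open>E (Suc m)\<close> compose to a pair in \<open>E m\<close>.\<close>

lemma weighted_chain_imp_mem:
  assumes sub: "\<And>n. E n \<subseteq> M \<times> M" and refl: "\<And>n. refl_on M (E n)"
    and triple: "\<And>n. E (Suc n) O E (Suc n) O E (Suc n) \<subseteq> E n"
    and "weighted_chain E k x y s" "x \<in> M" "s < (1/2)^m"
  shows "(x, y) \<in> E m"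
  using assms(4-6)
proof (induction k arbitrary: x y s m rule: less_induct)
  case (less k)
  have decr: "antimono E"
  proof (rule decseq_SucI)
    fix n show "E (Suc n) \<subseteq> E n"
    proof clarify
      fix a b assume ab: "(a, b) \<in> E (Suc n)"
      \<comment> \<open>Padding with the diagonal pair at \<open>b\<close> turns a single pair into
        a composition of three, so \<open>triple\<close> also yields monotonicity.\<close>
      then have "(b, b) \<in> E (Suc n)" using sub refl by (meson mem_Sigma_iff refl_onD subsetD)
      with ab have "(a, b) \<in> E (Suc n) O E (Suc n) O E (Suc n)" by (meson relcompI)
      with triple show "(a, b) \<in> E n" by (rule subsetD)
    qed
  qed
  show ?case
  proof (cases "k = 0")
    case True
    with less.prems(1) have "x = y" by (auto elim: weighted_chain.cases)
    with less.prems(2) refl show ?thesis by (auto simp: refl_on_def)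
  next
    case False
    have s0: "0 \<le> s" using less.prems(1) by (rule weighted_chain_nonneg)
    obtain i a s1 n b j s2 where
      *: "weighted_chain E i x a s1" "(a, b) \<in> E n" "weighted_chain E j b y s2" "i < k" "j < k"
        "s1 + (1/2)^n + s2 = s" "s1 \<le> s / 2" "s2 \<le> max 0 (s - s / 2)"
      using weighted_chain_split[OF less.prems(1), of "s / 2"] False s0 by auto
    have "s / 2 < (1/2)^Suc m" using less.prems(3) by simp
    with *(7,8) s0 have half: "s1 < (1/2)^Suc m" "s2 < (1/2)^Suc m" by linarith+
    have "(x, a) \<in> E (Suc m)"
      by (rule less.IH[OF *(4,1) less.prems(2) half(1)])
    moreover have "(b, y) \<in> E (Suc m)"
      using less.IH[OF *(5,3) _ half(2)] *(2) sub by blast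
    moreover have "(a, b) \<in> E (Suc m)"
    proof -
      have "(1/2::real)^n < (1/2)^m"
        using *(6) less.prems(3) weighted_chain_nonneg[OF *(1)] weighted_chain_nonneg[OF *(3)]
        by linarith
      then have "Suc m \<le> n" by (simp add: power_strict_decreasing_iff)
      with *(2) show ?thesis using antimonoD[OF decr] by blast
    qed
    ultimately show ?thesis using triple[of m] by blast
  qed
qed

text \<open>The distance is the infimum of the weights of all chains between two points. A single
  link gives the upper bound, \<open>weighted_chain_imp_mem\<close> gives the lower one, and the
  latter together with \<open>sep\<close> makes \<open>d\<close> vanish only on the diagonal. By
  \<open>E0\<close> any two points of \<open>M\<close> are joined by a chain, so the infimum is
  taken over a nonempty set.\<close>

theorem Frink_metrization:
  fixes E :: "nat \<Rightarrow> 'a rel"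
  assumes E0: "E 0 = M \<times> M" and sub: "\<And>n. E n \<subseteq> M \<times> M"
    and refl: "\<And>n. refl_on M (E n)" and sym: "\<And>n. sym (E n)"
    and triple: "\<And>n. E (Suc n) O E (Suc n) O E (Suc n) \<subseteq> E n"
    and sep: "(\<Inter>n. E n) \<subseteq> Id"
  obtains d where "Metric_space M d"
    and "\<And>x y n. (x, y) \<in> E n \<Longrightarrow> d x y \<le> (1/2)^n"
    and "\<And>x y n. x \<in> M \<Longrightarrow> y \<in> M \<Longrightarrow> d x y < (1/2)^n \<Longrightarrow> (x, y) \<in> E n"
proof -
  define S where "S = (\<lambda>x y. {s. \<exists>k. weighted_chain E k x y s})"
  \<comment> \<open>\<open>Metric_space\<close> demands nonnegativity at all points, also outside
    \<open>M\<close>, where \<open>S x y\<close> can be empty and its \<open>Inf\<close> arbitrary;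
    hence the default 0.\<close>
  define d where "d = (\<lambda>x y. if x \<in> M \<and> y \<in> M then Inf (S x y) else 0)"
  have S_nonneg: "0 \<le> s" if "s \<in> S x y" for s x y
    using that by (auto simp: S_def weighted_chain_nonneg)
  then have bdd: "bdd_below (S x y)" for x y by (meson bdd_belowI)
  have S_single: "(1/2)^n \<in> S x y" if "(x, y) \<in> E n" for x y n
    unfolding S_def using weighted_chain_single[of x y E, OF that] by blast
  have S_ne: "S x y \<noteq> {}" if "x \<in> M" "y \<in> M" for x y
    using S_single[of x y 0] that E0 by auto
  have S_sym: "S x y = S y x" for x y
    unfolding S_def using weighted_chain_sym[of E, OF sym] by blast
  have upper: "d x y \<le> (1/2)^n" if "(x, y) \<in> E n" for x y n
    using that sub[of n] cInf_lower[OF S_single[OF that] bdd] by (auto simp: d_def)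
  have lower: "(x, y) \<in> E n" if M: "x \<in> M" "y \<in> M" and less: "d x y < (1/2)^n" for x y n
  proof -
    obtain s where "s \<in> S x y" "s < (1/2)^n"
      using M less cInf_lessD[OF S_ne[OF M]] by (auto simp: d_def)
    then show ?thesis
      using weighted_chain_imp_mem[of E M, OF sub refl triple] M(1) by (auto simp: S_def)
  qed
  have "Metric_space M d"
  proof
    show "0 \<le> d x y" for x y
      using cInf_greatest[OF S_ne S_nonneg] by (auto simp: d_def)
    show "d x y = d y x" for x y
      by (auto simp: d_def S_sym[of x y])
    show "d x y = 0 \<longleftrightarrow> x = y" if "x \<in> M" "y \<in> M" for x y
    proof
      assume "d x y = 0"
      then have "(x, y) \<in> E n" for n using lower that by simp
      then show "x = y" using sep by auto
    next
      assume "x = y"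
      then have "0 \<in> S x y" unfolding S_def using weighted_chain.refl[of E x] by auto
      then have "Inf (S x y) = 0"
        using cInf_eq_minimum S_nonneg by blast
      then show "d x y = 0" by (simp add: d_def)
    qed
    show "d x z \<le> d x y + d y z" if M: "x \<in> M" "y \<in> M" "z \<in> M" for x y z
    proof -
      have *: "Inf (S x z) \<le> s + t" if "s \<in> S x y" "t \<in> S y z" for s t
      proof (rule cInf_lower[OF _ bdd])
        show "s + t \<in> S x z" using that weighted_chain_append by (fastforce simp: S_def)
      qed
      \<comment> \<open>The infimum is taken over \<open>s\<close> with \<open>t\<close> fixed, and
        only then over \<open>t\<close>.\<close>
      have "Inf (S x z) - t \<le> Inf (S x y)" if "t \<in> S y z" for t
        using *[OF _ that] by (intro cInf_greatest[OF S_ne[OF M(1,2)]]) (simp add: algebra_simps)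
      then have "Inf (S x z) - Inf (S x y) \<le> Inf (S y z)"
        by (intro cInf_greatest[OF S_ne[OF M(2,3)]]) (simp add: algebra_simps)
      then show ?thesis using M by (simp add: d_def)
    qed
  qed
  then show ?thesis using that upper lower by blast
qed

section \<open>Neighbourhoods of the identity in a paratopological group\<close>

context paratopological_group
begin

lemma continuous_map_left_mult:
  assumes "g \<in> carrier G"
  shows "continuous_map \<tau> \<tau> (\<lambda>x. g \<otimes> x)"
proof -
  have "continuous_map \<tau> (prod_topology \<tau> \<tau>) (\<lambda>x. (g, x))"
    using assms by (simp add: continuous_map_pairwise o_def topspace_eq_carrier)
  from continuous_map_compose[OF this continuous_mult] show ?thesis by (simp add: o_def)
qed

text \<open>The set is the translate of \<open>W\<close> by the inverse of \<open>g\<close>. Only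
  multiplication by a fixed element is involved, so inversion need not be continuous.\<close>

lemma openin_left_mult_vimage:
  assumes "g \<in> carrier G" "openin \<tau> W"
  shows "openin \<tau> {x \<in> carrier G. g \<otimes> x \<in> W}"
  using openin_continuous_map_preimage[OF continuous_map_left_mult[OF assms(1)] assms(2)]
  by (simp add: topspace_eq_carrier)

lemma neighbourhood_mult:
  assumes "openin \<tau> W" "\<one> \<in> W"
  obtains V where "openin \<tau> V" "\<one> \<in> V" "\<And>x y. x \<in> V \<Longrightarrow> y \<in> V \<Longrightarrow> x \<otimes> y \<in> W"
proof -
  let ?P = "{p \<in> topspace (prod_topology \<tau> \<tau>). (case p of (x, y) \<Rightarrow> x \<otimes> y) \<in> W}"
  have "openin (prod_topology \<tau> \<tau>) ?P"
    using openin_continuous_map_preimage[OF continuous_mult assms(1)] .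
  moreover have "(\<one>, \<one>) \<in> ?P" using assms(2) by (simp add: topspace_eq_carrier)
  ultimately obtain A B where "openin \<tau> A" "openin \<tau> B" "\<one> \<in> A" "\<one> \<in> B" "A \<times> B \<subseteq> ?P"
    unfolding openin_prod_topology_alt by meson
  then show ?thesis by (intro that[of "A \<inter> B"]) auto
qed

text \<open>Halving twice: \<open>x \<otimes> y\<close> lies in \<open>V\<close> for factors from
  \<open>V'\<close>, and its product with an element of \<open>V\<close> lies in
  \<open>W\<close>.\<close>

lemma neighbourhood_mult3:
  assumes "openin \<tau> W" "\<one> \<in> W"
  obtains V where "openin \<tau> V" "\<one> \<in> V"
    "\<And>x y z. x \<in> V \<Longrightarrow> y \<in> V \<Longrightarrow> z \<in> V \<Longrightarrow> x \<otimes> y \<otimes> z \<in> W"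
proof -
  obtain V where V: "openin \<tau> V" "\<one> \<in> V" "\<And>x y. x \<in> V \<Longrightarrow> y \<in> V \<Longrightarrow> x \<otimes> y \<in> W"
    using neighbourhood_mult[OF assms] by metis
  obtain V' where V': "openin \<tau> V'" "\<one> \<in> V'" "\<And>x y. x \<in> V' \<Longrightarrow> y \<in> V' \<Longrightarrow> x \<otimes> y \<in> V"
    using neighbourhood_mult[OF V(1,2)] by metis
  show ?thesis using V V' by (intro that[of "V \<inter> V'"]) auto
qed

text \<open>Each next set is obtained from \<open>neighbourhood_mult3\<close> and then cut down to
  the corresponding member of an enumerated local base, so that the sequence is itself a base at
  \<open>\<one>\<close>. Starting with the whole group will make the first entourage the full
  relation.\<close>

lemma first_countable_neighbourhood_sequence:
  assumes "first_countable \<tau>"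
  obtains U where "U 0 = carrier G" "\<And>n. openin \<tau> (U n)" "\<And>n. \<one> \<in> U n"
    "\<And>n x y z. x \<in> U (Suc n) \<Longrightarrow> y \<in> U (Suc n) \<Longrightarrow> z \<in> U (Suc n) \<Longrightarrow> x \<otimes> y \<otimes> z \<in> U n"
    "\<And>W. openin \<tau> W \<Longrightarrow> \<one> \<in> W \<Longrightarrow> \<exists>n. U n \<subseteq> W"
proof -
  obtain \<B> where "countable \<B>" and \<B>_open: "\<And>V. V \<in> \<B> \<Longrightarrow> openin \<tau> V"
    and \<B>_base: "\<And>W. openin \<tau> W \<Longrightarrow> \<one> \<in> W \<Longrightarrow> \<exists>V\<in>\<B>. \<one> \<in> V \<and> V \<subseteq> W"
    using assms unfolding first_countable_def topspace_eq_carrier by (metis one_closed)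
  \<comment> \<open>The family given by first countability may have members that miss
    \<open>\<one>\<close>.\<close>
  define \<C> where "\<C> = {V \<in> \<B>. \<one> \<in> V}"
  have "countable \<C>" using \<open>countable \<B>\<close> by (auto simp: \<C>_def)
  moreover have "\<C> \<noteq> {}"
    using \<B>_base[of "carrier G"] openin_topspace[of \<tau>] by (auto simp: \<C>_def topspace_eq_carrier)
  ultimately obtain B :: "nat \<Rightarrow> 'a set" where B: "range B = \<C>"
    by (metis range_from_nat_into)
  then have B_nbh: "openin \<tau> (B n)" "\<one> \<in> B n" for n
    using \<B>_open by (auto simp: \<C>_def)
  \<comment> \<open>The conjunct about \<open>n = 0\<close> fixes the start of the recursion and is
    vacuous at successors.\<close>
  have "\<exists>U. \<forall>n. (openin \<tau> (U n) \<and> \<one> \<in> U n \<and> (n = 0 \<longrightarrow> U n = carrier G)) \<and>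
      (U (Suc n) \<subseteq> B n \<and>
        (\<forall>x\<in>U (Suc n). \<forall>y\<in>U (Suc n). \<forall>z\<in>U (Suc n). x \<otimes> y \<otimes> z \<in> U n))"
  proof (rule dependent_nat_choice)
    show "\<exists>U. openin \<tau> U \<and> \<one> \<in> U \<and> ((0::nat) = 0 \<longrightarrow> U = carrier G)"
      using openin_topspace[of \<tau>] by (auto simp: topspace_eq_carrier)
  next
    fix W and n :: nat assume "openin \<tau> W \<and> \<one> \<in> W \<and> (n = 0 \<longrightarrow> W = carrier G)"
    then obtain V where "openin \<tau> V" "\<one> \<in> V"
      "\<And>x y z. x \<in> V \<Longrightarrow> y \<in> V \<Longrightarrow> z \<in> V \<Longrightarrow> x \<otimes> y \<otimes> z \<in> W"
      using neighbourhood_mult3[of W] by auto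
    then show "\<exists>V. (openin \<tau> V \<and> \<one> \<in> V \<and> (Suc n = 0 \<longrightarrow> V = carrier G)) \<and>
        (V \<subseteq> B n \<and> (\<forall>x\<in>V. \<forall>y\<in>V. \<forall>z\<in>V. x \<otimes> y \<otimes> z \<in> W))"
      using B_nbh[of n] by (intro exI[of _ "V \<inter> B n"]) auto
  qed
  then obtain U where *: "\<forall>n. (openin \<tau> (U n) \<and> \<one> \<in> U n \<and> (n = 0 \<longrightarrow> U n = carrier G)) \<and>
      (U (Suc n) \<subseteq> B n \<and>
        (\<forall>x\<in>U (Suc n). \<forall>y\<in>U (Suc n). \<forall>z\<in>U (Suc n). x \<otimes> y \<otimes> z \<in> U n))" ..
  have "\<exists>n. U n \<subseteq> W" if W: "openin \<tau> W" "\<one> \<in> W" for W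
  proof -
    obtain V where "V \<in> \<C>" "V \<subseteq> W" using \<B>_base[OF W] by (auto simp: \<C>_def)
    with B obtain n where "B n \<subseteq> W" by auto
    with * show ?thesis by (meson subset_trans)
  qed
  with * show ?thesis by (intro that[of U]) auto
qed

end

section \<open>Entourages from translated neighbourhoods and the resulting metric\<close>

theorem corollary3p9:
  fixes G :: "('a, 'b) monoid_scheme" and \<tau> :: "'a topology"
  assumes "paratopological_group G \<tau>"
    and "comm_group G"
    and "Hausdorff_space \<tau>"
    and "first_countable \<tau>"
  shows "submetrizable \<tau>"
proof -
  interpret paratopological_group G \<tau> by (rule assms(1))
  interpret comm_group G by (rule assms(2))
  obtain U where U0: "U 0 = carrier G" and U_open: "\<And>n. openin \<tau> (U n)"
    and U_one: "\<And>n. \<one>\<^bsub>G\<^esub> \<in> U n"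
    and U_mult: "\<And>n x y z. x \<in> U (Suc n) \<Longrightarrow> y \<in> U (Suc n) \<Longrightarrow> z \<in> U (Suc n) \<Longrightarrow>
      x \<otimes>\<^bsub>G\<^esub> y \<otimes>\<^bsub>G\<^esub> z \<in> U n"
    and U_base: "\<And>W. openin \<tau> W \<Longrightarrow> \<one>\<^bsub>G\<^esub> \<in> W \<Longrightarrow> \<exists>n. U n \<subseteq> W"
    using first_countable_neighbourhood_sequence[OF assms(4)] by metis
  have U_carrier: "u \<in> carrier G" if "u \<in> U n" for u n
    using that openin_subset[OF U_open] by (auto simp: topspace_eq_carrier)
  \<comment> \<open>The condition says that the quotient of \<open>y\<close> by \<open>x\<close> has
    the form \<open>u\<close> times the inverse of \<open>v\<close>. Requiring the quotient to lie
    in \<open>U n\<close> would not give a symmetric relation, since \<open>U n\<close> need not be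
    closed under inverses.\<close>
  define E where "E = (\<lambda>n. {(x, y). x \<in> carrier G \<and> y \<in> carrier G \<and>
    (\<exists>u\<in>U n. \<exists>v\<in>U n. x \<otimes>\<^bsub>G\<^esub> u = y \<otimes>\<^bsub>G\<^esub> v)})"
  obtain d where d: "Metric_space (carrier G) d"
    and d_le: "\<And>x y n. (x, y) \<in> E n \<Longrightarrow> d x y \<le> (1/2)^n"
  proof (rule Frink_metrization[of E "carrier G"])
    show "E 0 = carrier G \<times> carrier G"
    proof -
      \<comment> \<open>Commutativity provides the witnesses \<open>u = y\<close> and
        \<open>v = x\<close>.\<close>
      have "\<exists>u\<in>carrier G. \<exists>v\<in>carrier G. x \<otimes>\<^bsub>G\<^esub> u = y \<otimes>\<^bsub>G\<^esub> v"
        if "x \<in> carrier G" "y \<in> carrier G" for x y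
        using that m_comm by blast
      then show ?thesis by (auto simp: E_def U0)
    qed
    show "E n \<subseteq> carrier G \<times> carrier G" for n by (auto simp: E_def)
    show "refl_on (carrier G) (E n)" for n using U_one by (auto simp: E_def refl_on_def)
    show "sym (E n)" for n 
      by (intro symI, simp add: E_def) (metis (no_types))
    show "E (Suc n) O E (Suc n) O E (Suc n) \<subseteq> E n" for n
    proof clarify
      fix x y z w assume "(x, y) \<in> E (Suc n)" "(y, z) \<in> E (Suc n)" "(z, w) \<in> E (Suc n)"
      then obtain a a' b b' c c' where U: "a \<in> U (Suc n)" "a' \<in> U (Suc n)" "b \<in> U (Suc n)"
          "b' \<in> U (Suc n)" "c \<in> U (Suc n)" "c' \<in> U (Suc n)"
        and eq: "x \<otimes>\<^bsub>G\<^esub> a = y \<otimes>\<^bsub>G\<^esub> a'" "y \<otimes>\<^bsub>G\<^esub> b = z \<otimes>\<^bsub>G\<^esub> b'" "z \<otimes>\<^bsub>G\<^esub> c = w \<otimes>\<^bsub>G\<^esub> c'"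
        and G: "x \<in> carrier G" "y \<in> carrier G" "z \<in> carrier G" "w \<in> carrier G"
        unfolding E_def by blast
      note closed = G U[THEN U_carrier]
      \<comment> \<open>The witnesses for \<open>(x, w)\<close> are the products of
        \<open>a, b, c\<close> and of \<open>a', b', c'\<close>, both in \<open>U n\<close> by
        \<open>U_mult\<close>. Commutativity regroups the factors so that the three equations can be
        applied one after the other.\<close>
      have "x \<otimes>\<^bsub>G\<^esub> (a \<otimes>\<^bsub>G\<^esub> b \<otimes>\<^bsub>G\<^esub> c) = (x \<otimes>\<^bsub>G\<^esub> a) \<otimes>\<^bsub>G\<^esub> (b \<otimes>\<^bsub>G\<^esub> c)"
        using closed by (simp add: m_ac)
      also have "\<dots> = (y \<otimes>\<^bsub>G\<^esub> b) \<otimes>\<^bsub>G\<^esub> (a' \<otimes>\<^bsub>G\<^esub> c)"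
        unfolding eq(1) using closed by (simp add: m_ac)
      also have "\<dots> = (z \<otimes>\<^bsub>G\<^esub> c) \<otimes>\<^bsub>G\<^esub> (a' \<otimes>\<^bsub>G\<^esub> b')"
        unfolding eq(2) using closed by (simp add: m_ac)
      also have "\<dots> = w \<otimes>\<^bsub>G\<^esub> (a' \<otimes>\<^bsub>G\<^esub> b' \<otimes>\<^bsub>G\<^esub> c')"
        unfolding eq(3) using closed by (simp add: m_ac)
      finally show "(x, w) \<in> E n"
        using U_mult U G unfolding E_def by blast
    qed
    show "(\<Inter>n. E n) \<subseteq> Id"
    proof clarify
      fix x y assume xy: "(x, y) \<in> (\<Inter>n. E n)"
      then have G: "x \<in> carrier G" "y \<in> carrier G" by (auto simp: E_def)
      show "x = y"
      proof (rule ccontr)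
        assume "x \<noteq> y"
        then obtain A B where AB: "openin \<tau> A" "openin \<tau> B" "x \<in> A" "y \<in> B" "disjnt A B"
          using assms(3) G unfolding Hausdorff_space_def topspace_eq_carrier by meson
        \<comment> \<open>Translation by \<open>x\<close> takes \<open>?W\<close> into
          \<open>A\<close> and translation by \<open>y\<close> takes it into \<open>B\<close>, so
          once \<open>U n\<close> lies in \<open>?W\<close> the two translates of \<open>U n\<close>
          cannot meet.\<close>
        let ?W = "{u \<in> carrier G. x \<otimes>\<^bsub>G\<^esub> u \<in> A} \<inter> {u \<in> carrier G. y \<otimes>\<^bsub>G\<^esub> u \<in> B}"
        have "openin \<tau> ?W" using openin_left_mult_vimage G AB(1,2) by blast
        moreover have "\<one>\<^bsub>G\<^esub> \<in> ?W" using G AB(3,4) by simp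
        ultimately obtain n where "U n \<subseteq> ?W" using U_base by blast
        moreover obtain u v where "u \<in> U n" "v \<in> U n" "x \<otimes>\<^bsub>G\<^esub> u = y \<otimes>\<^bsub>G\<^esub> v"
          using xy unfolding E_def by blast
        ultimately have "x \<otimes>\<^bsub>G\<^esub> u \<in> A \<inter> B" by auto
        with AB(5) show False by (auto simp: disjnt_def)
      qed
    qed
  qed (rule that)
  interpret M: Metric_space "carrier G" d by (rule d)
  have "continuous_map \<tau> M.mtopology (\<lambda>x. x)"
    unfolding M.continuous_map_to_metric topspace_eq_carrier
  proof (intro ballI allI impI)
    fix x and \<epsilon> :: real assume x: "x \<in> carrier G" and "\<epsilon> > 0"
    then obtain n where n: "(1/2)^n < \<epsilon>" using real_arch_pow_inv[of \<epsilon> "1/2"] by auto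
    \<comment> \<open>This is the translate of \<open>U n\<close> by \<open>x\<close>. For
      \<open>y\<close> in it, the pair \<open>(x, y)\<close> is in \<open>E n\<close> with the
      quotient of \<open>y\<close> by \<open>x\<close> and \<open>\<one>\<close> as
      witnesses.\<close>
    let ?V = "{y \<in> carrier G. inv\<^bsub>G\<^esub> x \<otimes>\<^bsub>G\<^esub> y \<in> U n}"
    have "y \<in> M.mball x \<epsilon>" if "y \<in> ?V" for y
    proof -
      have "x \<otimes>\<^bsub>G\<^esub> (inv\<^bsub>G\<^esub> x \<otimes>\<^bsub>G\<^esub> y) = y \<otimes>\<^bsub>G\<^esub> \<one>\<^bsub>G\<^esub>"
        using x that by (simp flip: m_assoc)
      then have "(x, y) \<in> E n" using x that U_one unfolding E_def by blast
      with d_le n x that show ?thesis by (fastforce simp: M.in_mball)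
    qed
    moreover have "openin \<tau> ?V" using x by (intro openin_left_mult_vimage U_open) auto
    moreover have "x \<in> ?V" using x U_one by simp
    ultimately show "\<exists>V. openin \<tau> V \<and> x \<in> V \<and> (\<forall>y\<in>V. y \<in> M.mball x \<epsilon>)" by blast
  qed
  then show ?thesis
    by (rule submetrizableI[OF d]) (simp_all add: topspace_eq_carrier)
qed

end
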